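(* Let $n\ge 1$ and let $$F(x_1,\dots,x_n)=\sum_{i,j=1}^{n} q_{ij}x_ix_j+2\sum_{i=1}^{n} q_i x_i+q_0=0$$ be an algebraic Diophantine equation of the second order with integer coefficients, where $Q=(q_{ij})$ is the symmetric matrix of its quadratic form. Assume that there is an integer translation $x_i=x_i'+x_{i0}$, $x_{i0}\in\mathbb{Z}$ $(1\le i\le n)$, which converts the equation either to the form $$\sum_{i,j=1}^{n} q_{ij}x_i'x_j'+q_0'=0$$ or to the form $$\sum_{i,j=1}^{n-1} q_{ij}x_i'x_j'+2q_n'x_n'=0,$$ with integer coefficients. Suppose that $Q$ has $n$ pairwise orthogonal non-zero eigenvectors with integer coordinates $$a_1=(a_{11},\dots,a_{1n}),\ \dots,\ a_n=(a_{n1},\dots,a_{nn}).$$ Then the matrix whose columns are these eigenvectors, $$C=\begin{pmatrix} a_{11} & \dots & a_{n1}\\ \vdots & & \vdots\\ a_{1n} & \dots & a_{nn}\end{pmatrix},$$ is the matrix of an integer generalized orthogonal transformation, and the substitution $x'=Cx''$ reduces the (translated) equation to a diagonal form.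
   Context: A generalized orthogonal transformation is a (non-degenerate) transformation that preserves the perpendicularity of the basis vectors but not necessarily their lengths: it is an orthogonal transformation with matrix $S$ followed by a stretching $x_i'=k_ix_i''$ of the basis vectors with non-zero real coefficients $k_1,\dots,k_n$, so that its matrix is $S\cdot\mathrm{diag}(k_1,\dots,k_n)$. It is called integer if all entries of its matrix are integers. A second-order equation is in diagonal form if its quadratic part contains no cross terms, i.e. the matrix of its quadratic form is diagonal. *)

theory Defs
  imports "Jordan_Normal_Form.Char_Poly"
begin

text \<open>Indices run over 0, ..., n - 1, so the last variable has index n - 1. Equations have real
  coefficients and integrality is stated separately. A polynomial of degree at most two is
  identified with the function it induces on n-dimensional real vectors.\<close>

definition quad_poly :: "nat \<Rightarrow> real mat \<Rightarrow> real vec \<Rightarrow> real \<Rightarrow> real vec \<Rightarrow> real" where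
  "quad_poly n Q q q0 x =
     (\<Sum>i<n. \<Sum>j<n. Q $$ (i,j) * x $ i * x $ j) + 2 * (\<Sum>i<n. q $ i * x $ i) + q0"

definition second_order_data :: "nat \<Rightarrow> real mat \<Rightarrow> real vec \<Rightarrow> bool" where
  "second_order_data n Q q \<longleftrightarrow>
     Q \<in> carrier_mat n n \<and> transpose_mat Q = Q \<and> Q \<noteq> 0\<^sub>m n n \<and> q \<in> carrier_vec n"

text \<open>For symmetric Q, the coefficient of the monomial in variables i and j, i distinct from j, is
  twice the entry of Q at (i,j), and that of the linear monomial in variable i is twice the i-th
  entry of q. It is these coefficients of the polynomial that are integers. The special case in
  which all entries of Q and q are integers is included.\<close>

definition integer_coeffs :: "nat \<Rightarrow> real mat \<Rightarrow> real vec \<Rightarrow> real \<Rightarrow> bool" where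
  "integer_coeffs n Q q q0 \<longleftrightarrow>
     (\<forall>i<n. Q $$ (i,i) \<in> \<int>) \<and> (\<forall>i<n. \<forall>j<n. i \<noteq> j \<longrightarrow> 2 * Q $$ (i,j) \<in> \<int>) \<and>
     (\<forall>i<n. 2 * q $ i \<in> \<int>) \<and> q0 \<in> \<int>"

definition in_diagonal_form :: "nat \<Rightarrow> (real vec \<Rightarrow> real) \<Rightarrow> bool" where
  "in_diagonal_form n G \<longleftrightarrow>
     (\<exists>D d d0. second_order_data n D d \<and> diagonal_mat D \<and>
        (\<forall>x\<in>carrier_vec n. G x = quad_poly n D d d0 x))"

definition integer_vec :: "nat \<Rightarrow> real vec \<Rightarrow> bool" where
  "integer_vec n v \<longleftrightarrow> v \<in> carrier_vec n \<and> (\<forall>i<n. v $ i \<in> \<int>)"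

text \<open>The library's \<^const>\<open>orthogonal_mat\<close> only asks for pairwise orthogonal non-zero columns; here
  S is an orthogonal matrix in the usual sense.\<close>

definition generalized_orthogonal :: "nat \<Rightarrow> real mat \<Rightarrow> bool" where
  "generalized_orthogonal n A \<longleftrightarrow>
     (\<exists>S k. S \<in> carrier_mat n n \<and> transpose_mat S * S = 1\<^sub>m n \<and> S * transpose_mat S = 1\<^sub>m n \<and>
        (\<forall>i<n. k i \<noteq> 0) \<and> A = S * mat_diag n k)"

definition integer_generalized_orthogonal :: "nat \<Rightarrow> real mat \<Rightarrow> bool" where
  "integer_generalized_orthogonal n A \<longleftrightarrow>
     generalized_orthogonal n A \<and> (\<forall>i<n. \<forall>j<n. A $$ (i,j) \<in> \<int>)"

end

theory Submission
  imports Defs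
begin

text \<open>Pairwise orthogonality of the columns of C says that the Gram matrix of C is diagonal, with
  the squared lengths of the columns on its diagonal; these are positive, since the columns are
  non-zero. Rescaling the columns to unit length therefore gives an orthogonal matrix S, and C is
  S times the diagonal matrix of the lengths (\<open>generalized_orthogonal_mat_of_cols\<close>).

  A second-order polynomial stays one under any affine substitution \<open>x = C x'' + x0\<close>, and its
  quadratic part becomes the congruent matrix \<open>C\<^sup>T Q C\<close> (\<open>quad_poly_affine\<close>). The entry of this
  matrix at (i,j) is \<open>a\<^sub>i \<bullet> Q a\<^sub>j\<close>, which is an eigenvalue times \<open>a\<^sub>i \<bullet> a\<^sub>j\<close> and hence vanishes off the
  diagonal (\<open>diagonal_congruence_eigenvectors\<close>). The quadratic part does not disappear altogether,
  because C is invertible: a congruence by C can be undone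
  (\<open>generalized_orthogonal_right_inverse\<close>).

  The substitution is thus performed on the translated polynomial as a whole; whichever of the two
  normal forms the translation produces, only a linear and a constant part are added to the
  diagonalized quadratic part, and these contain no cross terms.\<close>

section \<open>Pairwise orthogonal columns\<close>

text \<open>The two-sided condition on S comes from the one-sided one: a left inverse of a square matrix
  over a field is also a right inverse.\<close>

lemma generalized_orthogonal_mat_of_cols:
  fixes a :: "real vec list"
  assumes len: "length a = n"
    and carrier: "\<And>i. i < n \<Longrightarrow> a ! i \<in> carrier_vec n"
    and nonzero: "\<And>i. i < n \<Longrightarrow> a ! i \<noteq> 0\<^sub>v n"
    and orth: "\<And>i j. i < n \<Longrightarrow> j < n \<Longrightarrow> i \<noteq> j \<Longrightarrow> a ! i \<bullet> a ! j = 0"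
  shows "generalized_orthogonal n (mat_of_cols n a)"
proof -
  define k where "k i = sqrt (a ! i \<bullet> a ! i)" for i
  define b where "b i = (1 / k i) \<cdot>\<^sub>v a ! i" for i
  define S where "S = mat n n (\<lambda>(i, j). b j $ i)"
  have pos: "a ! i \<bullet> a ! i > 0" if "i < n" for i
  proof -
    have "a ! i \<bullet> a ! i \<ge> 0"
      unfolding scalar_prod_def by (intro sum_nonneg) auto
    moreover have "a ! i \<bullet> a ! i \<noteq> 0"
    proof
      assume "a ! i \<bullet> a ! i = 0"
      then have "(\<Sum>m<n. (a ! i $ m) * (a ! i $ m)) = 0"
        using carrier[OF that] by (simp add: scalar_prod_def atLeast0LessThan)
      then have "\<forall>m<n. a ! i $ m = 0"
        by (subst (asm) sum_nonneg_eq_0_iff) auto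
      then have "a ! i = 0\<^sub>v n"
        using carrier[OF that] by (intro eq_vecI) auto
      then show False using nonzero[OF that] by simp
    qed
    ultimately show ?thesis by simp
  qed
  have k_pos: "k i > 0" if "i < n" for i
    using pos[OF that] by (simp add: k_def)
  have k_sq: "k i * k i = a ! i \<bullet> a ! i" if "i < n" for i
    using pos[OF that] by (simp add: k_def)
  have S: "S \<in> carrier_mat n n" by (simp add: S_def)
  have b: "b i \<in> carrier_vec n" if "i < n" for i
    using carrier[OF that] by (simp add: b_def)
  have col_S: "col S i = b i" if "i < n" for i
    using that b[OF that] by (intro eq_vecI) (auto simp: S_def)
  have b_prod: "b i \<bullet> b j = (if i = j then 1 else 0)" if ij: "i < n" "j < n" for i j
  proof -
    have "b i \<bullet> b j = (a ! i \<bullet> a ! j) / (k i * k j)"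
      using carrier[OF ij(1)] carrier[OF ij(2)] by (simp add: b_def)
    then show ?thesis
      using orth[OF ij] k_sq[OF ij(1)] k_pos[OF ij(1)] by auto
  qed
  have StS: "transpose_mat S * S = 1\<^sub>m n"
    using S by (intro eq_matI) (auto simp: col_S b_prod)
  then have SSt: "S * transpose_mat S = 1\<^sub>m n"
    using mat_mult_left_right_inverse[of "transpose_mat S" n S] S by auto
  have "mat_of_cols n a = S * mat_diag n k"
  proof (rule eq_matI)
    fix i j
    assume "i < dim_row (S * mat_diag n k)" "j < dim_col (S * mat_diag n k)"
    then have ij: "i < n" "j < n" using S by (auto simp: mat_diag_def)
    have "(S * mat_diag n k) $$ (i, j) = S $$ (i, j) * k j"
      using mat_diag_mult_right[OF S, of k] ij by simp
    also have "\<dots> = a ! j $ i"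
      using ij carrier[OF ij(2)] k_pos[OF ij(2)] by (simp add: S_def b_def)
    finally show "mat_of_cols n a $$ (i, j) = (S * mat_diag n k) $$ (i, j)"
      using ij len by (simp add: mat_of_cols_index)
  qed (use S len in \<open>auto simp: mat_diag_def\<close>)
  moreover have "\<forall>i<n. k i \<noteq> 0" using k_pos by force
  ultimately show ?thesis
    unfolding generalized_orthogonal_def using S StS SSt by blast
qed

lemma generalized_orthogonal_right_inverse:
  assumes "generalized_orthogonal n A"
  obtains B where "B \<in> carrier_mat n n" "A * B = 1\<^sub>m n"
proof -
  obtain S k where S: "S \<in> carrier_mat n n" and SSt: "S * transpose_mat S = 1\<^sub>m n"
    and k: "\<forall>i<n. k i \<noteq> (0 :: real)" and A: "A = S * mat_diag n k"
    using assms unfolding generalized_orthogonal_def by blast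
  define K where "K = mat_diag n k"
  define L where "L = mat_diag n (\<lambda>i. 1 / k i)"
  have K: "K \<in> carrier_mat n n" and L: "L \<in> carrier_mat n n"
    by (simp_all add: K_def L_def mat_diag_def)
  have KL: "K * L = 1\<^sub>m n"
    unfolding K_def L_def mat_diag_diag using k by (intro eq_matI) (auto simp: mat_diag_def)
  have St: "transpose_mat S \<in> carrier_mat n n" using S by simp
  have "A * (L * transpose_mat S) = S * (K * L) * transpose_mat S"
    unfolding A K_def[symmetric] using S K L St
    by (simp add: assoc_mult_mat[of _ n n _ n _ n])
  then have "A * (L * transpose_mat S) = 1\<^sub>m n"
    using KL S SSt by simp
  with L St show ?thesis using that by (metis mult_carrier_mat)
qed

section \<open>Second-order polynomials under affine substitutions\<close>

lemma quad_poly_scalar_prod: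
  assumes "Q \<in> carrier_mat n n" "q \<in> carrier_vec n" "x \<in> carrier_vec n"
  shows "quad_poly n Q q q0 x = x \<bullet> (Q *\<^sub>v x) + 2 * (q \<bullet> x) + q0"
proof -
  have "x \<bullet> (Q *\<^sub>v x) = (\<Sum>i<n. \<Sum>j<n. Q $$ (i, j) * x $ i * x $ j)"
    using assms
    by (auto simp: scalar_prod_def atLeast0LessThan sum_distrib_left mult_ac
        intro!: sum.cong)
  moreover have "q \<bullet> x = (\<Sum>i<n. q $ i * x $ i)"
    using assms by (simp add: scalar_prod_def atLeast0LessThan)
  ultimately show ?thesis by (simp add: quad_poly_def)
qed

text \<open>By symmetry of Q the two mixed terms in C x and the translation vector agree. Together they
  are absorbed into the linear part, and the constant part is the value at the translation
  vector.\<close>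

lemma quad_poly_affine:
  assumes Q: "Q \<in> carrier_mat n n" and sym: "transpose_mat Q = Q"
    and q: "q \<in> carrier_vec n" and C: "C \<in> carrier_mat n n"
    and x0: "x0 \<in> carrier_vec n" and x: "x \<in> carrier_vec n"
  shows "quad_poly n Q q q0 (C *\<^sub>v x + x0) =
    quad_poly n (transpose_mat C * Q * C) (transpose_mat C *\<^sub>v (Q *\<^sub>v x0 + q))
      (quad_poly n Q q q0 x0) x"
proof -
  define y where "y = C *\<^sub>v x"
  have y: "y \<in> carrier_vec n" using C x by (simp add: y_def)
  have Qy: "Q *\<^sub>v y \<in> carrier_vec n" and Qx0: "Q *\<^sub>v x0 \<in> carrier_vec n"
    using Q y x0 by simp_all
  have adj: "v \<bullet> (M *\<^sub>v w) = (transpose_mat M *\<^sub>v v) \<bullet> w"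
    if "M \<in> carrier_mat n n" "v \<in> carrier_vec n" "w \<in> carrier_vec n"
    for M :: "real mat" and v w
    using transpose_vec_mult_scalar[OF that(1,3,2)] by simp
  have mixed: "x0 \<bullet> (Q *\<^sub>v y) = (Q *\<^sub>v x0) \<bullet> y"
    using adj[OF Q x0 y] sym by simp
  have mixed': "y \<bullet> (Q *\<^sub>v x0) = (Q *\<^sub>v x0) \<bullet> y"
    using y Qx0 by (rule comm_scalar_prod)
  have "quad_poly n Q q q0 (y + x0) =
      (y + x0) \<bullet> (Q *\<^sub>v y + Q *\<^sub>v x0) + 2 * (q \<bullet> (y + x0)) + q0"
    using Q q y x0 by (simp add: quad_poly_scalar_prod mult_add_distrib_mat_vec)
  also have "\<dots> = y \<bullet> (Q *\<^sub>v y) + 2 * ((Q *\<^sub>v x0 + q) \<bullet> y) + quad_poly n Q q q0 x0"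
    using Q q y x0 Qy Qx0 mixed mixed'
    by (simp add: quad_poly_scalar_prod add_scalar_prod_distrib[of _ n]
        scalar_prod_add_distrib[of _ n])
  also have "y \<bullet> (Q *\<^sub>v y) = x \<bullet> ((transpose_mat C * Q * C) *\<^sub>v x)"
  proof -
    have "x \<bullet> ((transpose_mat C * Q * C) *\<^sub>v x) = x \<bullet> (transpose_mat C *\<^sub>v (Q *\<^sub>v y))"
      using C Q x by (simp add: y_def assoc_mult_mat_vec[of _ n n _ n])
    also have "\<dots> = y \<bullet> (Q *\<^sub>v y)"
      using adj[of "transpose_mat C" x "Q *\<^sub>v y"] C x Qy by (simp add: y_def)
    finally show ?thesis by simp
  qed
  also have "(Q *\<^sub>v x0 + q) \<bullet> y = (transpose_mat C *\<^sub>v (Q *\<^sub>v x0 + q)) \<bullet> x"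
    unfolding y_def using adj[OF C, of "Q *\<^sub>v x0 + q" x] Qx0 q x by simp
  finally show ?thesis
    unfolding y_def
    using C Q q x x0 by (simp add: quad_poly_scalar_prod)
qed

lemma diagonal_congruence_eigenvectors:
  fixes Q :: "real mat"
  assumes Q: "Q \<in> carrier_mat n n" and len: "length a = n"
    and eig: "\<And>i. i < n \<Longrightarrow> \<exists>l. eigenvector Q (a ! i) l"
    and orth: "\<And>i j. i < n \<Longrightarrow> j < n \<Longrightarrow> i \<noteq> j \<Longrightarrow> a ! i \<bullet> a ! j = 0"
  shows "diagonal_mat (transpose_mat (mat_of_cols n a) * Q * mat_of_cols n a)"
proof -
  let ?C = "mat_of_cols n a"
  have C: "?C \<in> carrier_mat n n" using len by (simp add: mat_of_cols_def)
  have carrier: "a ! i \<in> carrier_vec n" if "i < n" for i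
    using eig[OF that] Q by (auto simp: eigenvector_def)
  have "(transpose_mat ?C * Q * ?C) $$ (i, j) = 0" if ij: "i < n" "j < n" "i \<noteq> j" for i j
  proof -
    obtain l where l: "Q *\<^sub>v (a ! j) = l \<cdot>\<^sub>v a ! j"
      using eig[OF ij(2)] by (auto simp: eigenvector_def)
    have "transpose_mat ?C * Q * ?C = transpose_mat ?C * (Q * ?C)"
      using C Q by (intro assoc_mult_mat[of _ n n _ n _ n]) auto
    then have "(transpose_mat ?C * Q * ?C) $$ (i, j) = col ?C i \<bullet> (Q *\<^sub>v col ?C j)"
      using C Q ij len carrier by (simp add: mult_mat_vec_def)
    also have "\<dots> = l * (a ! i \<bullet> a ! j)"
      using ij len carrier[OF ij(1)] carrier[OF ij(2)] l by simp
    finally show ?thesis using orth[OF ij] by simp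
  qed
  then show ?thesis
    unfolding diagonal_mat_def using len by (simp del: index_mult_mat(1))
qed

lemma congruence_nonzero:
  fixes Q :: "'a :: comm_ring_1 mat"
  assumes Q: "Q \<in> carrier_mat n n" and C: "C \<in> carrier_mat n n" and B: "B \<in> carrier_mat n n"
    and CB: "C * B = 1\<^sub>m n" and "Q \<noteq> 0\<^sub>m n n"
  shows "transpose_mat C * Q * C \<noteq> 0\<^sub>m n n"
proof
  assume zero: "transpose_mat C * Q * C = 0\<^sub>m n n"
  have Ct: "transpose_mat C \<in> carrier_mat n n" and Bt: "transpose_mat B \<in> carrier_mat n n"
    using C B by simp_all
  have BtCt: "transpose_mat B * transpose_mat C = 1\<^sub>m n"
    using transpose_mult[OF C B] CB by simp
  \<comment> \<open>Congruence by B undoes congruence by C.\<close>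
  have "Q = (transpose_mat B * transpose_mat C) * Q * (C * B)"
    using BtCt CB Q by simp
  also have "\<dots> = transpose_mat B * ((transpose_mat C * Q * C) * B)"
    using Q B C Bt Ct by (simp add: assoc_mult_mat[of _ n n _ n _ n])
  also have "\<dots> = 0\<^sub>m n n"
    unfolding zero using B Bt by simp
  finally show False using assms(5) by simp
qed

section \<open>Reduction to diagonal form\<close>

theorem mainTheorem2:
  fixes n :: nat and Q :: "real mat" and q :: "real vec" and q0 :: real
    and x0 :: "real vec" and a :: "real vec list"
  assumes "n \<ge> 1"
    and "second_order_data n Q q"
    and "integer_coeffs n Q q q0"
    and "integer_vec n x0"
    and "(\<exists>q0'. q0' \<in> \<int> \<and>
            (\<forall>x'\<in>carrier_vec n. quad_poly n Q q q0 (x' + x0) =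
               (\<Sum>i<n. \<Sum>j<n. Q $$ (i,j) * x' $ i * x' $ j) + q0')) \<or>
         (\<exists>qn'. 2 * qn' \<in> \<int> \<and>
            (\<forall>x'\<in>carrier_vec n. quad_poly n Q q q0 (x' + x0) =
               (\<Sum>i<n - 1. \<Sum>j<n - 1. Q $$ (i,j) * x' $ i * x' $ j) + 2 * qn' * x' $ (n - 1)))"
    and "length a = n"
    and "\<forall>i<n. integer_vec n (a ! i) \<and> (\<exists>l. eigenvector Q (a ! i) l)"
    and "\<forall>i<n. \<forall>j<n. i \<noteq> j \<longrightarrow> a ! i \<bullet> a ! j = 0"
  shows "integer_generalized_orthogonal n (mat_of_cols n a) \<and>
         in_diagonal_form n (\<lambda>x''. quad_poly n Q q q0 (mat_of_cols n a *\<^sub>v x'' + x0))"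
proof -
  let ?C = "mat_of_cols n a"
  let ?D = "transpose_mat ?C * Q * ?C"
  let ?d = "transpose_mat ?C *\<^sub>v (Q *\<^sub>v x0 + q)"
  have Q: "Q \<in> carrier_mat n n" and sym: "transpose_mat Q = Q" and Q0: "Q \<noteq> 0\<^sub>m n n"
    and q: "q \<in> carrier_vec n"
    using assms(2) by (auto simp: second_order_data_def)
  have x0: "x0 \<in> carrier_vec n" using assms(4) by (simp add: integer_vec_def)
  have eig: "\<exists>l. eigenvector Q (a ! i) l" if "i < n" for i using assms(7) that by blast
  have carrier: "a ! i \<in> carrier_vec n" and nonzero: "a ! i \<noteq> 0\<^sub>v n" if "i < n" for i
    using eig[OF that] Q by (auto simp: eigenvector_def)
  have orth: "a ! i \<bullet> a ! j = 0" if "i < n" "j < n" "i \<noteq> j" for i j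
    using assms(8) that by blast
  have C: "?C \<in> carrier_mat n n" using assms(6) by (simp add: mat_of_cols_def)
  have gen: "generalized_orthogonal n ?C"
    using assms(6) carrier nonzero orth by (rule generalized_orthogonal_mat_of_cols)
  have int: "\<forall>i<n. \<forall>j<n. ?C $$ (i, j) \<in> \<int>"
    using assms(6,7) by (auto simp: mat_of_cols_index integer_vec_def)
  obtain B where "B \<in> carrier_mat n n" "?C * B = 1\<^sub>m n"
    using gen by (rule generalized_orthogonal_right_inverse)
  then have "?D \<noteq> 0\<^sub>m n n" using congruence_nonzero[OF Q C] Q0 by blast
  moreover have "transpose_mat ?D = ?D"
  proof -
    have "transpose_mat ?D = transpose_mat ?C * (transpose_mat Q * ?C)"
      using C Q by (simp add: transpose_mult[of _ n n _ n])
    also have "\<dots> = ?D"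
      unfolding sym using C Q by (simp add: assoc_mult_mat[of _ n n _ n _ n])
    finally show ?thesis .
  qed
  ultimately have "second_order_data n ?D ?d"
    using C Q q x0 by (auto simp: second_order_data_def)
  moreover have "diagonal_mat ?D"
    using Q assms(6) eig orth by (rule diagonal_congruence_eigenvectors)
  moreover have "\<forall>x\<in>carrier_vec n.
      quad_poly n Q q q0 (?C *\<^sub>v x + x0) = quad_poly n ?D ?d (quad_poly n Q q q0 x0) x"
    using quad_poly_affine[OF Q sym q C x0] by blast
  ultimately have "in_diagonal_form n (\<lambda>x''. quad_poly n Q q q0 (?C *\<^sub>v x'' + x0))"
    unfolding in_diagonal_form_def by blast
  with gen int show ?thesis by (simp add: integer_generalized_orthogonal_def)
qed

end
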